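(* For every nonnegative integer $m$ and every complex number $z$, $$\binom{m}{z}=\sum_{k=0}^{m}\binom{m}{k}\,\mathrm{sinc}(z-k).$$
   Context: For $w\in\mathbb{C}$ not a negative integer and $z\in\mathbb{C}$, the generalized binomial coefficient is $\binom{w}{z}=\frac{\Gamma(w+1)}{\Gamma(z+1)\Gamma(w-z+1)}$, where the reciprocal gamma function $1/\Gamma$ is understood as an entire function (equal to $0$ at the nonpositive integers). For integers $0\le k\le m$ this is the usual binomial coefficient. The function $\mathrm{sinc}:\mathbb{C}\to\mathbb{C}$ is defined by $\mathrm{sinc}(0)=1$ and $\mathrm{sinc}(z)=\frac{\sin(\pi z)}{\pi z}$ for $z\neq 0$. *)

theory Defs
  imports "HOL-Analysis.Analysis"
begin

text \<open>
  The library's \<open>rGamma\<close> is the entire function \<open>1 / Gamma\<close>, with value 0 at the nonpositive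
  integers. The definition is meaningful only if \<open>w\<close> is not a negative integer; at a negative
  integer \<open>w\<close> the totalised \<open>Gamma\<close> makes it 0. Note that \<open>gchoose\<close> is not applicable, as its
  lower argument is a natural number.
\<close>

definition gen_binomial :: "complex \<Rightarrow> complex \<Rightarrow> complex" where
  "gen_binomial w z = Gamma (w + 1) * rGamma (z + 1) * rGamma (w - z + 1)"

lemma gen_binomial_of_nat:
  assumes "k \<le> m"
  shows "gen_binomial (of_nat m) (of_nat k) = of_nat (m choose k)"
proof -
  have G: "Gamma (of_nat n + 1 :: complex) = fact n" for n
    using Gamma_fact[of n, where 'a = complex] by (simp add: add.commute)
  have "(of_nat m :: complex) - of_nat k + 1 = of_nat (m - k) + 1"
    using assms by (simp add: of_nat_diff)
  then have "gen_binomial (of_nat m) (of_nat k)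
      = fact m * inverse (fact k) * inverse (fact (m - k))"
    by (simp only: gen_binomial_def rGamma_inverse_Gamma G)
  also have "\<dots> = of_nat (m choose k)"
    using assms by (simp add: binomial_fact field_simps)
  finally show ?thesis .
qed

text \<open>The normalised cardinal sine, with the factor \<open>pi\<close>.\<close>

definition csinc :: "complex \<Rightarrow> complex" where
  "csinc z = (if z = 0 then 1 else sin (of_real pi * z) / (of_real pi * z))"

end

theory Submission
  imports Defs
begin

text \<open>
  Both sides satisfy the Pascal recurrence \<open>F (m + 1) z = F m z + F m (z - 1)\<close>, so induction on \<open>m\<close>
  reduces the identity to \<open>m = 0\<close>, which is Euler's reflection formula.
\<close>

lemma gen_binomial_0_left: "gen_binomial 0 z = csinc z"
proof (cases "z = 0")
  case False
  \<comment> \<open>The factor \<open>z\<close> turns \<open>rGamma (z + 1)\<close> into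
    \<open>rGamma z\<close>, the form that the reflection formula needs; it is cancelled at the end
    since \<open>z \<noteq> 0\<close>.\<close>
  have "z * gen_binomial 0 z = rGamma z * rGamma (1 - z)"
    using rGamma_plus1[of z] by (simp add: gen_binomial_def flip: mult.assoc)
  also have "\<dots> = sin (of_real pi * z) / of_real pi"
    by (rule rGamma_reflection_complex)
  finally show ?thesis
    using False by (simp add: csinc_def field_simps)
qed (simp add: gen_binomial_def csinc_def)

text \<open>By the functional equation of \<open>rGamma\<close>, which has no poles to avoid, all
  three terms are multiples of \<open>fact m * a * b\<close>. The cofactors on the right are
  \<open>m - z + 1\<close> and \<open>z\<close>, with sum \<open>m + 1\<close>.\<close>

lemma gen_binomial_Suc_left:
  "gen_binomial (of_nat (Suc m)) z = gen_binomial (of_nat m) z + gen_binomial (of_nat m) (z - 1)"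
proof -
  define a where "a = rGamma (z + 1)"
  define b where "b = rGamma (of_nat m - z + 2)"
  have 1: "rGamma z = z * a"
    unfolding a_def by (rule rGamma_plus1[symmetric])
  have 2: "rGamma (of_nat m - z + 1) = (of_nat m - z + 1) * b"
    using rGamma_plus1[of "of_nat m - z + 1"] by (simp add: b_def add.assoc)
  have G: "Gamma (of_nat n + 1 :: complex) = fact n" for n
    using Gamma_fact[of n, where 'a = complex] by (simp add: add.commute)
  have 3: "of_nat m - (z - 1) + 1 = of_nat m - z + 2" "of_nat (Suc m) - z + 1 = of_nat m - z + 2"
    by simp_all
  have "gen_binomial (of_nat m) z + gen_binomial (of_nat m) (z - 1)
      = fact m * a * ((of_nat m - z + 1) * b) + fact m * (z * a) * b"
    by (simp only: gen_binomial_def G 1 2 3 diff_add_cancel flip: a_def b_def)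
  also have "\<dots> = fact (Suc m) * a * b"
    by (simp add: algebra_simps)
  also have "\<dots> = gen_binomial (of_nat (Suc m)) z"
    by (simp only: gen_binomial_def G 3 flip: a_def b_def)
  finally show ?thesis by simp
qed

lemma sum_binomial_Suc_mult:
  fixes f :: "nat \<Rightarrow> 'a :: comm_semiring_1"
  shows "(\<Sum>k\<le>Suc m. of_nat (Suc m choose k) * f k)
       = (\<Sum>k\<le>m. of_nat (m choose k) * f k) + (\<Sum>k\<le>m. of_nat (m choose k) * f (Suc k))"
proof -
  \<comment> \<open>The added term vanishes because \<open>m choose Suc m = 0\<close>. Splitting off
    index 0 then leaves the range \<open>k \<le> m\<close> in every sum, so Pascal's rule applies
    termwise.\<close>
  have "(\<Sum>k\<le>m. of_nat (m choose k) * f k) = (\<Sum>k\<le>Suc m. of_nat (m choose k) * f k)"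
    by (simp add: binomial_eq_0)
  also have "\<dots> = f 0 + (\<Sum>k\<le>m. of_nat (m choose Suc k) * f (Suc k))"
    by (subst sum.atMost_Suc_shift) simp
  finally have "(\<Sum>k\<le>m. of_nat (m choose k) * f k)
      = f 0 + (\<Sum>k\<le>m. of_nat (m choose Suc k) * f (Suc k))" .
  then show ?thesis
    by (subst sum.atMost_Suc_shift) (simp add: sum.distrib algebra_simps)
qed

theorem theorem1:
  fixes m :: nat and z :: complex
  shows "gen_binomial (of_nat m) z = (\<Sum>k=0..m. of_nat (m choose k) * csinc (z - of_nat k))"
  unfolding atLeast0AtMost
proof (induction m arbitrary: z)
  case 0
  show ?case by (simp add: gen_binomial_0_left)
next
  case (Suc m)
  have "gen_binomial (of_nat (Suc m)) z
      = gen_binomial (of_nat m) z + gen_binomial (of_nat m) (z - 1)"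
    by (rule gen_binomial_Suc_left)
  \<comment> \<open>The induction hypothesis is used at both \<open>z\<close> and
    \<open>z - 1\<close>, hence the generalization over \<open>z\<close>; the shift by 1 moves into
    the index as \<open>Suc k\<close>.\<close>
  also have "\<dots> = (\<Sum>k\<le>m. of_nat (m choose k) * csinc (z - of_nat k))
      + (\<Sum>k\<le>m. of_nat (m choose k) * csinc (z - of_nat (Suc k)))"
    by (simp add: Suc.IH diff_diff_eq)
  also have "\<dots> = (\<Sum>k\<le>Suc m. of_nat (Suc m choose k) * csinc (z - of_nat k))"
    by (rule sum_binomial_Suc_mult[symmetric])
  finally show ?case .
qed

end
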